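(* Suppose that the following statement holds: for every union-closed family $\mathcal{A}$ with base set $[n]$, if $y\in[n]$ satisfies $|\mathcal{A}_{\{y\}}|=\max_{x\in[n]}|\mathcal{A}_{\{x\}}|$ and there exists $z\in[n]$ such that $\mathcal{A}=\mathcal{A}_{\{y\}}\cup\mathcal{A}_{\{z\}}$, then $|\mathcal{A}_{\{y\}}|\geq 2|\mathcal{A}_{\underline{\{y\}}}|$. Then for every union-closed family $\mathcal{A}$ with base set $[n]$, there exists an element of $[n]$ that belongs to at least $\frac{|\mathcal{A}|}{2}$ member sets of $\mathcal{A}$.
   Context: A family of sets $\mathcal{A}$ is union-closed if it is a finite nonempty collection of distinct finite sets, at least one of which is nonempty, such that $X,Y\in\mathcal{A}$ implies $X\cup Y\in\mathcal{A}$. The base set of $\mathcal{A}$ is $\bigcup_{A\in\mathcal{A}}A$; up to relabeling of elements it is represented by $[n]=\{1,2,\dots,n\}$, where $n\geq 1$ is its cardinality (both statements are for all $n$ and all such families, and are invariant under relabeling). For an element $x$, $\mathcal{A}_{\{x\}}=\{A\in\mathcal{A} : x\in A\}$ and $\mathcal{A}_{\underline{\{x\}}}=\{A\in\mathcal{A} : x\notin A\}$. *)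

theory Defs
  imports Complex_Main
begin

definition union_closed :: "'a set set \<Rightarrow> bool" where
  "union_closed \<A> \<longleftrightarrow>
     finite \<A> \<and> \<A> \<noteq> {} \<and> (\<forall>X\<in>\<A>. finite X) \<and> (\<exists>X\<in>\<A>. X \<noteq> {}) \<and>
     (\<forall>X\<in>\<A>. \<forall>Y\<in>\<A>. X \<union> Y \<in> \<A>)"

definition base_set :: "'a set set \<Rightarrow> 'a set" where
  "base_set \<A> = \<Union>\<A>"

definition members_with :: "'a set set \<Rightarrow> 'a \<Rightarrow> 'a set set" where
  "members_with \<A> x = {A \<in> \<A>. x \<in> A}"

definition members_without :: "'a set set \<Rightarrow> 'a \<Rightarrow> 'a set set" where
  "members_without \<A> x = {A \<in> \<A>. x \<notin> A}"

end

theory Submission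
  imports Defs
begin

text \<open>Suppose every element of the base set of a family \<open>\<A>\<close> of size \<open>N\<close> lies in fewer than
  \<open>N / 2\<close> members. Remove an inclusion-minimal member \<open>m\<close> to get \<open>\<A>' = \<A> - {m}\<close>; the union of a
  member of \<open>\<A>'\<close> with one of \<open>\<A>\<close> is in \<open>\<A>'\<close>. On two disjoint copies of the base set and two new
  points \<open>y, z\<close>, the sets \<open>X \<squnion> Y \<squnion> {y}\<close> with \<open>(X, Y) \<in> \<A>' \<times> \<A>\<close>, \<open>X \<squnion> Y \<squnion> {z}\<close> with
  \<open>(X, Y) \<in> \<A> \<times> \<A>'\<close> and \<open>X \<squnion> Y \<squnion> {y, z}\<close> with \<open>(X, Y) \<in> \<A>' \<times> \<A>'\<close> form a union-closed family
  covered by \<open>y\<close> and \<open>z\<close>. Here \<open>y\<close> has the maximal frequency \<open>(N - 1) (2 N - 1)\<close>, which is less than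
  twice the number \<open>N (N - 1)\<close> of members avoiding \<open>y\<close>.\<close>

section \<open>Blocks: products of two families glued on shifted copies of the base set\<close>

text \<open>Adding \<open>n\<close> moves the second factor to the copy
  \<open>{n + 1..2 * n}\<close>, and \<open>S\<close> holds marker points, later taken beyond
  \<open>2 * n\<close>. The disjoint union thus stays inside \<open>nat\<close>, where the base set
  can again be an initial segment.\<close>

definition block :: "nat \<Rightarrow> nat set set \<Rightarrow> nat set set \<Rightarrow> nat set \<Rightarrow> nat set set" where
  "block n \<C> \<D> S = (\<lambda>(X, Y). X \<union> (+) n ` Y \<union> S) ` (\<C> \<times> \<D>)"

lemma blockI: "X \<in> \<C> \<Longrightarrow> Y \<in> \<D> \<Longrightarrow> X \<union> (+) n ` Y \<union> S \<in> block n \<C> \<D> S"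
  unfolding block_def by force

lemma blockE:
  assumes "Z \<in> block n \<C> \<D> S"
  obtains X Y where "X \<in> \<C>" "Y \<in> \<D>" "Z = X \<union> (+) n ` Y \<union> S"
  using assms unfolding block_def by auto

lemma finite_block: "finite \<C> \<Longrightarrow> finite \<D> \<Longrightarrow> finite (block n \<C> \<D> S)"
  unfolding block_def by simp

text \<open>Unions are formed separately in each factor and in the markers. The target families are
  left free because a union of sets from two different blocks may fall into a third one.\<close>

lemma block_Un:
  assumes "Z \<in> block n \<C> \<D> S" "Z' \<in> block n \<C>' \<D>' S'"
    and "\<And>X X'. X \<in> \<C> \<Longrightarrow> X' \<in> \<C>' \<Longrightarrow> X \<union> X' \<in> \<C>''"
    and "\<And>Y Y'. Y \<in> \<D> \<Longrightarrow> Y' \<in> \<D>' \<Longrightarrow> Y \<union> Y' \<in> \<D>''"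
    and "S'' = S \<union> S'"
  shows "Z \<union> Z' \<in> block n \<C>'' \<D>'' S''"
proof -
  obtain X Y where 1: "X \<in> \<C>" "Y \<in> \<D>" "Z = X \<union> (+) n ` Y \<union> S"
    using assms(1) by (rule blockE)
  obtain X' Y' where 2: "X' \<in> \<C>'" "Y' \<in> \<D>'" "Z' = X' \<union> (+) n ` Y' \<union> S'"
    using assms(2) by (rule blockE)
  have "Z \<union> Z' = (X \<union> X') \<union> (+) n ` (Y \<union> Y') \<union> S''"
    using 1 2 assms(5) by auto
  then show ?thesis
    using 1 2 assms(3,4) by (simp only: blockI)
qed

context
  fixes n :: nat and \<C> \<D> :: "nat set set" and S :: "nat set"
  assumes \<C>: "\<C> \<subseteq> Pow {1..n}" and \<D>: "\<D> \<subseteq> Pow {1..n}" and S: "S \<subseteq> {2 * n <..}"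
begin

text \<open>The two factors and the markers occupy the disjoint ranges \<open>{1..n}\<close>,
  \<open>{n + 1..2 * n}\<close> and \<open>{2 * n <..}\<close>, so each can be read off from the
  glued set.\<close>

lemma glue_mem_iff:
  assumes "X \<in> \<C>" "Y \<in> \<D>"
  shows "w \<in> {1..n} \<Longrightarrow> w \<in> X \<union> (+) n ` Y \<union> S \<longleftrightarrow> w \<in> X"
    and "w \<in> {1..n} \<Longrightarrow> n + w \<in> X \<union> (+) n ` Y \<union> S \<longleftrightarrow> w \<in> Y"
    and "w > 2 * n \<Longrightarrow> w \<in> X \<union> (+) n ` Y \<union> S \<longleftrightarrow> w \<in> S"
proof -
  have *: "X \<subseteq> {1..n}" "Y \<subseteq> {1..n}"
    using assms \<C> \<D> by auto
  show "w \<in> {1..n} \<Longrightarrow> w \<in> X \<union> (+) n ` Y \<union> S \<longleftrightarrow> w \<in> X"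
    using * S by fastforce
  show "w \<in> {1..n} \<Longrightarrow> n + w \<in> X \<union> (+) n ` Y \<union> S \<longleftrightarrow> w \<in> Y"
    using * S by fastforce
  show "w > 2 * n \<Longrightarrow> w \<in> X \<union> (+) n ` Y \<union> S \<longleftrightarrow> w \<in> S"
    using * by fastforce
qed

lemma card_block: "card (block n \<C> \<D> S) = card \<C> * card \<D>"
proof -
  have "inj_on (\<lambda>(X, Y). X \<union> (+) n ` Y \<union> S) (\<C> \<times> \<D>)"
  proof (rule inj_onI, clarify)
    fix X Y X' Y'
    assume m: "X \<in> \<C>" "Y \<in> \<D>" "X' \<in> \<C>" "Y' \<in> \<D>"
      and eq: "X \<union> (+) n ` Y \<union> S = X' \<union> (+) n ` Y' \<union> S"
    have "w \<in> X \<longleftrightarrow> w \<in> X'" if "w \<in> {1..n}" for w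
      using glue_mem_iff(1)[OF m(1,2) that] glue_mem_iff(1)[OF m(3,4) that] eq by metis
    moreover have "w \<in> Y \<longleftrightarrow> w \<in> Y'" if "w \<in> {1..n}" for w
      using glue_mem_iff(2)[OF m(1,2) that] glue_mem_iff(2)[OF m(3,4) that] eq by metis
    moreover have "X \<subseteq> {1..n}" "X' \<subseteq> {1..n}" "Y \<subseteq> {1..n}" "Y' \<subseteq> {1..n}"
      using m \<C> \<D> by auto
    ultimately show "X = X' \<and> Y = Y'"
      by blast
  qed
  then show ?thesis
    by (simp add: block_def card_image card_cartesian_product)
qed

text \<open>A point of either copy constrains only one factor, and a marker constrains neither. With
  \<open>card_block\<close>, frequencies in a block become products.\<close>

lemma members_with_block:
  shows "w \<in> {1..n} \<Longrightarrow> members_with (block n \<C> \<D> S) w = block n (members_with \<C> w) \<D> S"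
    and "w \<in> {1..n} \<Longrightarrow> members_with (block n \<C> \<D> S) (n + w) = block n \<C> (members_with \<D> w) S"
    and "w > 2 * n \<Longrightarrow> members_with (block n \<C> \<D> S) w = (if w \<in> S then block n \<C> \<D> S else {})"
proof -
  \<comment> \<open>Both sides become images under the same gluing map, so only the index sets
    remain to be compared.\<close>
  have im: "members_with (block n \<C> \<D> S) v =
      (\<lambda>(X, Y). X \<union> (+) n ` Y \<union> S) ` {(X, Y) \<in> \<C> \<times> \<D>. v \<in> X \<union> (+) n ` Y \<union> S}" for v
    unfolding members_with_def block_def by blast
  show "members_with (block n \<C> \<D> S) w = block n (members_with \<C> w) \<D> S" if "w \<in> {1..n}"
    unfolding im unfolding block_def members_with_def
    by (rule arg_cong2[where f = image, OF refl]) (use that glue_mem_iff(1) in blast)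
  show "members_with (block n \<C> \<D> S) (n + w) = block n \<C> (members_with \<D> w) S" if "w \<in> {1..n}"
    unfolding im unfolding block_def members_with_def
    by (rule arg_cong2[where f = image, OF refl]) (use that glue_mem_iff(2) in blast)
  show "members_with (block n \<C> \<D> S) w = (if w \<in> S then block n \<C> \<D> S else {})" if "w > 2 * n"
    unfolding members_with_def
    using that glue_mem_iff(3) by (auto elim!: blockE intro!: blockI)
qed

lemma block_Int_greaterThan: "Z \<in> block n \<C> \<D> S \<Longrightarrow> Z \<inter> {2 * n <..} = S"
  by (elim blockE) (use glue_mem_iff(3) S in blast)

end

section \<open>Counting members at a point, and minimal members\<close>

lemma members_with_Un: "members_with (\<A> \<union> \<B>) x = members_with \<A> x \<union> members_with \<B> x"
  unfolding members_with_def by blast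

lemma members_with_subset: "members_with \<A> x \<subseteq> \<A>"
  unfolding members_with_def by blast

lemma card_members_without:
  "finite \<A> \<Longrightarrow> card (members_without \<A> x) + card (members_with \<A> x) = card \<A>"
  unfolding members_with_def members_without_def
  by (subst card_Un_disjoint[symmetric]) (auto intro: arg_cong[where f = card])

text \<open>For an inclusion-minimal \<open>m\<close>, an equation \<open>X \<union> Y = m\<close>
  forces \<open>X \<subseteq> m\<close> and hence \<open>X = m\<close>, so no member other than
  \<open>m\<close> can have union \<open>m\<close> with anything.\<close>

lemma ex_minimal_member:
  assumes "union_closed \<A>"
  obtains m where "m \<in> \<A>" "\<And>X Y. X \<in> \<A> - {m} \<Longrightarrow> Y \<in> \<A> \<Longrightarrow> X \<union> Y \<in> \<A> - {m}"
proof -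
  obtain m where m: "m \<in> \<A>" "\<forall>X\<in>\<A>. X \<subseteq> m \<longrightarrow> m = X"
    using finite_has_minimal[of \<A>] assms unfolding union_closed_def by auto
  have "X \<union> Y \<in> \<A> - {m}" if "X \<in> \<A> - {m}" "Y \<in> \<A>" for X Y
    using that m assms unfolding union_closed_def by blast
  then show thesis
    using m(1) that by blast
qed

lemma index_cases:
  fixes w n :: nat
  assumes "w \<in> {1..2 * n + 2}"
  obtains "w \<in> {1..n}" | v where "v \<in> {1..n}" "w = n + v" | "w = 2 * n + 1" | "w = 2 * n + 2"
proof -
  consider "w \<le> n" | "n < w" "w \<le> 2 * n" | "w = 2 * n + 1" | "w = 2 * n + 2"
    using assms by fastforce
  then show thesis
    by cases (use assms that(1) that(2)[of "w - n"] that(3,4) in auto)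
qed

section \<open>The doubled family\<close>

text \<open>The markers \<open>2 * n + 1\<close> and \<open>2 * n + 2\<close> are the points y and
  z. The first certifies that the left factor lies in \<open>\<A>'\<close>, the second that the
  right factor does, and every set carries at least one of them.\<close>

definition doubling :: "nat \<Rightarrow> nat set set \<Rightarrow> nat set set \<Rightarrow> nat set set" where
  "doubling n \<A> \<A>' = block n \<A>' \<A> {2 * n + 1} \<union> block n \<A> \<A>' {2 * n + 2} \<union>
     block n \<A>' \<A>' {2 * n + 1, 2 * n + 2}"

context
  fixes n :: nat and \<A> \<A>' :: "nat set set"
  assumes \<A>: "union_closed \<A>" and base: "base_set \<A> = {1..n}"
    and \<A>': "\<A>' \<subseteq> \<A>" "\<A>' \<noteq> {}"
    and absorb: "\<And>X Y. X \<in> \<A>' \<Longrightarrow> Y \<in> \<A> \<Longrightarrow> X \<union> Y \<in> \<A>'"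
begin

lemma family_subsets: "\<A> \<subseteq> Pow {1..n}" "\<A>' \<subseteq> Pow {1..n}"
  using base \<A>' unfolding base_set_def by auto

lemma finite_families: "finite \<A>" "finite \<A>'"
  using \<A> \<A>'(1) finite_subset unfolding union_closed_def by auto

lemma finite_doubling: "finite (doubling n \<A> \<A>')"
  unfolding doubling_def by (simp add: finite_block finite_families)

text \<open>The three blocks are disjoint because their sets have different traces beyond
  \<open>2 * n\<close>. Arbitrary subfamilies are allowed as factors so that the formula serves both
  the whole doubled family and its restriction to one point.\<close>

lemma card_Un_blocks:
  assumes "\<C>1 \<subseteq> \<A>'" "\<D>1 \<subseteq> \<A>" "\<C>2 \<subseteq> \<A>" "\<D>2 \<subseteq> \<A>'" "\<C>3 \<subseteq> \<A>'" "\<D>3 \<subseteq> \<A>'"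
  shows "card (block n \<C>1 \<D>1 {2 * n + 1} \<union> block n \<C>2 \<D>2 {2 * n + 2} \<union>
      block n \<C>3 \<D>3 {2 * n + 1, 2 * n + 2}) =
    card \<C>1 * card \<D>1 + card \<C>2 * card \<D>2 + card \<C>3 * card \<D>3"
proof -
  have sub: "\<C>1 \<subseteq> Pow {1..n}" "\<D>1 \<subseteq> Pow {1..n}" "\<C>2 \<subseteq> Pow {1..n}" "\<D>2 \<subseteq> Pow {1..n}"
    "\<C>3 \<subseteq> Pow {1..n}" "\<D>3 \<subseteq> Pow {1..n}"
    using assms family_subsets by blast+
  have fin: "finite \<C>1" "finite \<D>1" "finite \<C>2" "finite \<D>2" "finite \<C>3" "finite \<D>3"
    by (rule finite_subset[OF _ finite_Pow_iff[THEN iffD2, OF finite_atLeastAtMost]], rule sub)+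
  let ?P = "block n \<C>1 \<D>1 {2 * n + 1}"
  let ?Q = "block n \<C>2 \<D>2 {2 * n + 2}"
  let ?R = "block n \<C>3 \<D>3 {2 * n + 1, 2 * n + 2}"
  have P: "Z \<inter> {2 * n <..} = {2 * n + 1}" if "Z \<in> ?P" for Z
    using block_Int_greaterThan[OF sub(1,2) _ that] by simp
  have Q: "Z \<inter> {2 * n <..} = {2 * n + 2}" if "Z \<in> ?Q" for Z
    using block_Int_greaterThan[OF sub(3,4) _ that] by simp
  have R: "Z \<inter> {2 * n <..} = {2 * n + 1, 2 * n + 2}" if "Z \<in> ?R" for Z
    using block_Int_greaterThan[OF sub(5,6) _ that] by simp
  have "?P \<inter> ?Q = {}" "?P \<inter> ?R = {}" "?Q \<inter> ?R = {}"
    using P Q R by fastforce+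
  moreover have "card ?P = card \<C>1 * card \<D>1" "card ?Q = card \<C>2 * card \<D>2"
      "card ?R = card \<C>3 * card \<D>3"
    using sub by (simp_all add: card_block)
  ultimately show ?thesis
    using fin by (simp add: card_Un_disjoint finite_block Int_Un_distrib2)
qed

lemma card_doubling:
  "card (doubling n \<A> \<A>') = card \<A>' * card \<A> + card \<A> * card \<A>' + card \<A>' * card \<A>'"
  unfolding doubling_def using \<A>' by (intro card_Un_blocks) auto

lemma card_members_with_doubling:
  shows "w \<in> {1..n} \<Longrightarrow> card (members_with (doubling n \<A> \<A>') w) =
      card (members_with \<A>' w) * card \<A> + card (members_with \<A> w) * card \<A>' +
      card (members_with \<A>' w) * card \<A>'"
    and "w \<in> {1..n} \<Longrightarrow> card (members_with (doubling n \<A> \<A>') (n + w)) =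
      card \<A>' * card (members_with \<A> w) + card \<A> * card (members_with \<A>' w) +
      card \<A>' * card (members_with \<A>' w)"
    and "card (members_with (doubling n \<A> \<A>') (2 * n + 1)) = card \<A>' * card \<A> + card \<A>' * card \<A>'"
    and "card (members_with (doubling n \<A> \<A>') (2 * n + 2)) = card \<A>' * card \<A> + card \<A>' * card \<A>'"
proof -
  note sub = family_subsets \<A>'(1) members_with_subset[THEN order_trans]
  show "card (members_with (doubling n \<A> \<A>') w) =
      card (members_with \<A>' w) * card \<A> + card (members_with \<A> w) * card \<A>' +
      card (members_with \<A>' w) * card \<A>'" if "w \<in> {1..n}"
  proof -
    have "members_with (doubling n \<A> \<A>') w = block n (members_with \<A>' w) \<A> {2 * n + 1} \<union>
      block n (members_with \<A> w) \<A>' {2 * n + 2} \<union>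
      block n (members_with \<A>' w) \<A>' {2 * n + 1, 2 * n + 2}"
      unfolding doubling_def using sub that by (simp add: members_with_Un members_with_block(1))
    then show ?thesis
      using \<A>'(1) by (simp only:, intro card_Un_blocks) (auto simp: members_with_def)
  qed
  show "card (members_with (doubling n \<A> \<A>') (n + w)) =
      card \<A>' * card (members_with \<A> w) + card \<A> * card (members_with \<A>' w) +
      card \<A>' * card (members_with \<A>' w)" if "w \<in> {1..n}"
  proof -
    have "members_with (doubling n \<A> \<A>') (n + w) = block n \<A>' (members_with \<A> w) {2 * n + 1} \<union>
      block n \<A> (members_with \<A>' w) {2 * n + 2} \<union>
      block n \<A>' (members_with \<A>' w) {2 * n + 1, 2 * n + 2}"
      unfolding doubling_def using sub that by (simp add: members_with_Un members_with_block(2))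
    then show ?thesis
      using \<A>'(1) by (simp only:, intro card_Un_blocks) (auto simp: members_with_def)
  qed
  \<comment> \<open>The block without the marker contributes nothing. It is written with empty
    factors to keep the three-block shape of \<open>card_Un_blocks\<close>.\<close>
  have "members_with (doubling n \<A> \<A>') (2 * n + 1) = block n \<A>' \<A> {2 * n + 1} \<union>
      block n {} {} {2 * n + 2} \<union> block n \<A>' \<A>' {2 * n + 1, 2 * n + 2}"
    unfolding doubling_def using sub
    by (simp add: members_with_Un members_with_block(3)) (simp add: block_def)
  then show "card (members_with (doubling n \<A> \<A>') (2 * n + 1)) = card \<A>' * card \<A> + card \<A>' * card \<A>'"
    using card_Un_blocks[of \<A>' \<A> "{}" "{}" \<A>' \<A>'] \<A>'(1) by simp
  have "members_with (doubling n \<A> \<A>') (2 * n + 2) = block n {} {} {2 * n + 1} \<union>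
      block n \<A> \<A>' {2 * n + 2} \<union> block n \<A>' \<A>' {2 * n + 1, 2 * n + 2}"
    unfolding doubling_def using sub
    by (simp add: members_with_Un members_with_block(3)) (simp add: block_def)
  then show "card (members_with (doubling n \<A> \<A>') (2 * n + 2)) = card \<A>' * card \<A> + card \<A>' * card \<A>'"
    using card_Un_blocks[of "{}" "{}" \<A> \<A>' \<A>' \<A>'] \<A>'(1) by simp
qed

lemma doubling_member_subset: "Z \<in> doubling n \<A> \<A>' \<Longrightarrow> Z \<subseteq> {1..2 * n + 2}"
  unfolding doubling_def using family_subsets by (fastforce elim!: blockE)

lemma doubling_covered:
  "doubling n \<A> \<A>' = members_with (doubling n \<A> \<A>') (2 * n + 1) \<union> members_with (doubling n \<A> \<A>') (2 * n + 2)"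
proof -
  have "2 * n + 1 \<in> Z \<or> 2 * n + 2 \<in> Z" if "Z \<in> doubling n \<A> \<A>'" for Z
    using that unfolding doubling_def by (auto elim!: blockE)
  then show ?thesis
    unfolding members_with_def by blast
qed

lemma base_set_doubling: "base_set (doubling n \<A> \<A>') = {1..2 * n + 2}"
proof
  show "base_set (doubling n \<A> \<A>') \<subseteq> {1..2 * n + 2}"
    using doubling_member_subset unfolding base_set_def by blast
  obtain X0 where X0: "X0 \<in> \<A>'"
    using \<A>'(2) by blast
  show "{1..2 * n + 2} \<subseteq> base_set (doubling n \<A> \<A>')"
  proof
    fix w assume "w \<in> {1..2 * n + 2}"
    then consider "w \<in> {1..n}" | v where "v \<in> {1..n}" "w = n + v" | "w = 2 * n + 1" | "w = 2 * n + 2"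
      by (rule index_cases)
    then show "w \<in> base_set (doubling n \<A> \<A>')"
    proof cases
      case 1
      then obtain X where "X \<in> \<A>" "w \<in> X"
        using base unfolding base_set_def by blast
      \<comment> \<open>The block whose left factor ranges over all of \<open>\<A>\<close> admits
        this \<open>X\<close>; the fixed \<open>X0\<close> fills the other factor.\<close>
      then show ?thesis
        using blockI[of X \<A> X0 \<A>' n "{2 * n + 2}"] X0 unfolding base_set_def doubling_def by blast
    next
      case 2
      then obtain X where "X \<in> \<A>" "v \<in> X"
        using base unfolding base_set_def by blast
      then show ?thesis
        using blockI[of X0 \<A>' X \<A> n "{2 * n + 1}"] X0 2 unfolding base_set_def doubling_def by blast
    qed (use blockI[of X0 \<A>' X0 \<A>' n "{2 * n + 1, 2 * n + 2}"] X0 in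
        \<open>unfold base_set_def doubling_def, blast+\<close>)
  qed
qed

text \<open>Membership of a factor in \<open>\<A>'\<close> survives unions with members of
  \<open>\<A>\<close>, by absorption, just as markers survive unions. What the markers certify
  therefore remains true of the union.\<close>

lemma union_closed_doubling: "union_closed (doubling n \<A> \<A>')"
  unfolding union_closed_def
proof (intro conjI ballI)
  have closed: "X \<union> Y \<in> \<A>" if "X \<in> \<A>" "Y \<in> \<A>" for X Y
    using that \<A> unfolding union_closed_def by blast
  have absorb': "X \<union> Y \<in> \<A>'" if "X \<in> \<A>" "Y \<in> \<A>'" for X Y
    using absorb[OF that(2,1)] by (simp add: Un_commute)
  have inner: "X \<union> Y \<in> \<A>'" if "X \<in> \<A>'" "Y \<in> \<A>'" for X Y
    using absorb that \<A>'(1) by blast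
  note cl = closed absorb absorb' inner
  show "finite (doubling n \<A> \<A>')"
    by (rule finite_doubling)
  show "\<exists>X\<in>doubling n \<A> \<A>'. X \<noteq> {}" "doubling n \<A> \<A>' \<noteq> {}"
  proof -
    have "2 * n + 1 \<in> \<Union> (doubling n \<A> \<A>')"
      using base_set_doubling unfolding base_set_def by simp
    then show "\<exists>X\<in>doubling n \<A> \<A>'. X \<noteq> {}" "doubling n \<A> \<A>' \<noteq> {}"
      by blast+
  qed
  show "finite X" if "X \<in> doubling n \<A> \<A>'" for X
    using doubling_member_subset[OF that] finite_subset by blast
  show "Z \<union> Z' \<in> doubling n \<A> \<A>'" if "Z \<in> doubling n \<A> \<A>'" "Z' \<in> doubling n \<A> \<A>'" for Z Z'
  proof -
    let ?P = "block n \<A>' \<A> {2 * n + 1}"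
    let ?Q = "block n \<A> \<A>' {2 * n + 2}"
    let ?R = "block n \<A>' \<A>' {2 * n + 1, 2 * n + 2}"
    \<comment> \<open>Of the nine ordered pairs of blocks, two equal pairs stay in \<open>?P\<close>
      or \<open>?Q\<close>; all others acquire both markers and land in \<open>?R\<close>.\<close>
    have "Z \<union> Z' \<in> ?P" if "Z \<in> ?P" "Z' \<in> ?P"
      by (rule block_Un[OF that]) (auto intro: cl)
    moreover have "Z \<union> Z' \<in> ?Q" if "Z \<in> ?Q" "Z' \<in> ?Q"
      by (rule block_Un[OF that]) (auto intro: cl)
    moreover have "Z \<union> Z' \<in> ?R" if "Z \<in> ?P" "Z' \<in> ?Q"
      by (rule block_Un[OF that]) (auto intro: cl)
    moreover have "Z \<union> Z' \<in> ?R" if "Z \<in> ?Q" "Z' \<in> ?P"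
      by (rule block_Un[OF that]) (auto intro: cl)
    moreover have "Z \<union> Z' \<in> ?R" if "Z \<in> ?P" "Z' \<in> ?R"
      by (rule block_Un[OF that]) (auto intro: cl)
    moreover have "Z \<union> Z' \<in> ?R" if "Z \<in> ?R" "Z' \<in> ?P"
      by (rule block_Un[OF that]) (auto intro: cl)
    moreover have "Z \<union> Z' \<in> ?R" if "Z \<in> ?Q" "Z' \<in> ?R"
      by (rule block_Un[OF that]) (auto intro: cl)
    moreover have "Z \<union> Z' \<in> ?R" if "Z \<in> ?R" "Z' \<in> ?Q"
      by (rule block_Un[OF that]) (auto intro: cl)
    moreover have "Z \<union> Z' \<in> ?R" if "Z \<in> ?R" "Z' \<in> ?R"
      by (rule block_Un[OF that]) (auto intro: cl)
    ultimately show ?thesis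
      using that unfolding doubling_def by (elim UnE) simp_all
  qed
qed

end

section \<open>Frequencies in the doubled family and the contradiction\<close>

theorem theorem3p6:
  assumes "\<And>(n::nat) (\<A> :: nat set set) y.
     n \<ge> 1 \<Longrightarrow> union_closed \<A> \<Longrightarrow> base_set \<A> = {1..n} \<Longrightarrow> y \<in> {1..n} \<Longrightarrow>
     card (members_with \<A> y) = (MAX x\<in>{1..n}. card (members_with \<A> x)) \<Longrightarrow>
     (\<exists>z\<in>{1..n}. \<A> = members_with \<A> y \<union> members_with \<A> z) \<Longrightarrow>
     card (members_with \<A> y) \<ge> 2 * card (members_without \<A> y)"
  shows "\<forall>(n::nat) (\<A> :: nat set set).
     n \<ge> 1 \<longrightarrow> union_closed \<A> \<longrightarrow> base_set \<A> = {1..n} \<longrightarrow>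
     (\<exists>x\<in>{1..n}. real (card (members_with \<A> x)) \<ge> real (card \<A>) / 2)"
proof (intro allI impI)
  fix n :: nat and \<A> :: "nat set set"
  assume n: "n \<ge> 1" and uc: "union_closed \<A>" and base: "base_set \<A> = {1..n}"
  show "\<exists>x\<in>{1..n}. real (card (members_with \<A> x)) \<ge> real (card \<A>) / 2"
  proof (rule ccontr)
    assume contra: "\<not> ?thesis"
    have rare: "2 * card (members_with \<A> x) < card \<A>" if "x \<in> {1..n}" for x
    proof -
      have "real (card (members_with \<A> x)) < real (card \<A>) / 2"
        using contra that not_le by blast
      then show ?thesis
        by linarith
    qed
    obtain m where m: "m \<in> \<A>" "\<And>X Y. X \<in> \<A> - {m} \<Longrightarrow> Y \<in> \<A> \<Longrightarrow> X \<union> Y \<in> \<A> - {m}"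
      using ex_minimal_member[OF uc] by blast
    define \<A>' where "\<A>' = \<A> - {m}"
    define k where "k = card \<A>'"
    have fin: "finite \<A>"
      using uc unfolding union_closed_def by blast
    then have card: "card \<A> = k + 1"
      using m(1) card_Suc_Diff1[of \<A> m] unfolding k_def \<A>'_def by simp
    \<comment> \<open>The point 1 lies in some member, so its rarity gives \<open>\<A>\<close> more
      than two members. This yields \<open>k > 0\<close>, needed both for
      \<open>\<A>' \<noteq> {}\<close> and for the final strict inequality.\<close>
    have "1 \<in> \<Union> \<A>"
      using base n unfolding base_set_def by simp
    then obtain X where "X \<in> \<A>" "1 \<in> X"
      by blast
    then have "card (members_with \<A> 1) > 0"
      using fin unfolding members_with_def by (auto simp: card_gt_0_iff)
    then have k: "k > 0"
      using rare[of 1] n card by simp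
    then have ne: "\<A>' \<noteq> {}"
      unfolding k_def by auto
    have sub: "\<A>' \<subseteq> \<A>"
      unfolding \<A>'_def by blast
    have absorb: "\<And>X Y. X \<in> \<A>' \<Longrightarrow> Y \<in> \<A> \<Longrightarrow> X \<union> Y \<in> \<A>'"
      using m(2) unfolding \<A>'_def .
    note ctxt = uc base sub ne absorb
    let ?B = "doubling n \<A> \<A>'"
    let ?y = "2 * n + 1"
    have y: "card (members_with ?B ?y) = k * (2 * k + 1)"
      using card_members_with_doubling(3)[OF ctxt] card unfolding k_def[symmetric]
      by (simp add: algebra_simps)
    \<comment> \<open>The left side is the frequency of a copied point, with \<open>a\<close> and
      \<open>a'\<close> its frequencies in \<open>\<A>\<close> and \<open>\<A>'\<close>. Since
      \<open>2 * a \<le> k\<close>, twice this is at most \<open>k * (3 * k + 1)\<close>, below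
      twice the frequency of \<open>?y\<close>.\<close>
    have bound: "a' * (k + 1) + a * k + a' * k \<le> k * (2 * k + 1)" if "a' \<le> a" "2 * a < k + 1" for a a'
    proof -
      have "2 * (a' * (k + 1) + a * k + a' * k) \<le> 2 * (a * (k + 1) + a * k + a * k)"
        using that(1) by (intro mult_le_mono add_mono) auto
      also have "\<dots> = (2 * a) * (3 * k + 1)"
        by (simp add: algebra_simps)
      also have "\<dots> \<le> k * (4 * k + 2)"
        using that(2) by (intro mult_le_mono) auto
      finally show ?thesis
        by (simp add: algebra_simps)
    qed
    have le: "card (members_with \<A>' v) \<le> card (members_with \<A> v)" for v
      using fin sub unfolding members_with_def by (intro card_mono) auto
    have max: "card (members_with ?B w) \<le> card (members_with ?B ?y)" if w: "w \<in> {1..2 * n + 2}" for w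
    proof -
      consider "w \<in> {1..n}" | v where "v \<in> {1..n}" "w = n + v" | "w = ?y" | "w = 2 * n + 2"
        by (rule index_cases[OF w])
      then show ?thesis
      proof cases
        case 1
        then show ?thesis
          using bound[OF le[of w]] rare[of w] card_members_with_doubling(1)[OF ctxt, of w]
          unfolding y card k_def[symmetric] by simp
      next
        case 2
        then show ?thesis
          using bound[OF le[of v]] rare[of v] card_members_with_doubling(2)[OF ctxt, of v]
          unfolding y card k_def[symmetric] by (simp add: algebra_simps)
      next
        case 4
        then show ?thesis
          using card_members_with_doubling(3,4)[OF ctxt] by simp
      qed simp
    qed
    have "card (members_with ?B ?y) = (MAX x\<in>{1..2 * n + 2}. card (members_with ?B x))"
      by (rule Max_eqI[symmetric]) (use max in auto)
    moreover have "\<exists>z\<in>{1..2 * n + 2}. ?B = members_with ?B ?y \<union> members_with ?B z"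
      using doubling_covered[OF ctxt] by (intro bexI[of _ "2 * n + 2"]) auto
    ultimately have "2 * card (members_without ?B ?y) \<le> card (members_with ?B ?y)"
      using union_closed_doubling[OF ctxt] base_set_doubling[OF ctxt] by (intro assms) auto
    \<comment> \<open>The total is \<open>2 * k * (k + 1) + k * k\<close>, from which
      \<open>k * (2 * k + 1)\<close> is subtracted.\<close>
    moreover have "card (members_without ?B ?y) = k * (k + 1)"
      using card_members_without[OF finite_doubling[OF ctxt], of ?y]
        card_doubling[OF ctxt] y card unfolding k_def[symmetric] by (simp add: algebra_simps)
    \<comment> \<open>The hypothesis would give
      \<open>2 * k * (k + 1) \<le> k * (2 * k + 1)\<close>, that is
      \<open>k \<le> 0\<close>.\<close>
    ultimately show False
      using k y by (simp add: algebra_simps)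
  qed
qed

end
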